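(* Let $T$ be a tree with $n\geq 4$ vertices. For any leaves $u,w$ of $T$, \[\frac{\operatorname{ecc}_T(u)}{\operatorname{ecc}_T(w)}\leq 2-\frac{2}{\lfloor \frac{n}{2}\rfloor}.\] For even $n$, equality holds if and only if $T$ has a longest path $P=uz_2z_3\ldots z_{n-1}$ and the leaf $w$ is adjacent to $z_{n/2}$. For odd $n$, equality holds if and only if $T$ has a longest path $P=uz_2z_3\ldots z_{n-2}$, the leaf $w$ is adjacent to $z_{(n-1)/2}$, and the remaining vertex $\omega$ is a leaf adjacent to $z_j$ for some $j\in\{2,\ldots,n-3\}$.
   Context: For a vertex $v$ of a tree $T$, $\operatorname{ecc}_T(v)=\max_{x\in V(T)} d_T(v,x)$. A leaf is a vertex of degree 1.
   Formalization: The "only if" parts of the equality characterizations are claimed only for n ≥ 6; they fail for n = 4 and n = 5 (paths P_4 and P_5 with u, w their ends attain equality). The inequality and the "if" parts are kept for all n ≥ 4. *)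

theory Defs
  imports "Graph_Theory.Graph_Theory"
begin

text \<open>
  A finite simple graph is a finite symmetric digraph without loops and parallel arcs (locale
  \<^locale>\<open>graph\<close>), every edge being represented by its two orientations. The library constant
  \<^const>\<open>tree\<close> does not apply to such digraphs: it forbids all directed cycles, and the two
  orientations of an edge already form one of length two. A cycle in the undirected sense is
  a directed cycle of length at least three.
\<close>

definition undirected_tree :: "('a, 'b) pre_digraph \<Rightarrow> bool" where
  "undirected_tree T \<longleftrightarrow>
     graph T \<and> Digraph_Component.connected T \<and>
     \<not> (\<exists>p. pre_digraph.cycle T p \<and> 3 \<le> length p)"

text \<open>
  With unit weights the shortest path weight \<^const>\<open>wf_digraph.\<mu>\<close> is the number of edges of a
  shortest walk; in a connected graph it is finite, so the conversion to \<^typ>\<open>real\<close> is harmless.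
\<close>

definition vdist :: "('a, 'b) pre_digraph \<Rightarrow> 'a \<Rightarrow> 'a \<Rightarrow> real" where
  "vdist T u v = real_of_ereal (wf_digraph.\<mu> T (\<lambda>_. 1) u v)"

definition ecc :: "('a, 'b) pre_digraph \<Rightarrow> 'a \<Rightarrow> real" where
  "ecc T v = Max (vdist T v ` verts T)"

text \<open>In a symmetric simple digraph the out-degree is the degree of the undirected graph.\<close>

definition leaf :: "('a, 'b) pre_digraph \<Rightarrow> 'a \<Rightarrow> bool" where
  "leaf T v \<longleftrightarrow> v \<in> verts T \<and> out_degree T v = 1"

definition longest_path :: "('a, 'b) pre_digraph \<Rightarrow> 'a list \<Rightarrow> bool" where
  "longest_path T p \<longleftrightarrow>
     vpath p T \<and> (\<forall>q. vpath q T \<longrightarrow> vwalk_length q \<le> vwalk_length p)"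

text \<open>
  The extremal configurations, for a tree on \<open>n\<close> vertices. The paths are written
  \<open>z 1, z 2, \<dots>\<close> with \<open>z 1 = u\<close>; note that \<open>[1..<n]\<close> lists the indices \<open>1, \<dots>, n - 1\<close> and
  \<open>[1..<n - 1]\<close> the indices \<open>1, \<dots>, n - 2\<close>.
\<close>

definition even_extremal :: "('a, 'b) pre_digraph \<Rightarrow> nat \<Rightarrow> 'a \<Rightarrow> 'a \<Rightarrow> bool" where
  "even_extremal T n u w \<longleftrightarrow>
     (\<exists>z. z 1 = u \<and> longest_path T (map z [1..<n]) \<and> w \<rightarrow>\<^bsub>T\<^esub> z (n div 2))"

definition odd_extremal :: "('a, 'b) pre_digraph \<Rightarrow> nat \<Rightarrow> 'a \<Rightarrow> 'a \<Rightarrow> bool" where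
  "odd_extremal T n u w \<longleftrightarrow>
     (\<exists>z \<omega>. z 1 = u \<and> longest_path T (map z [1..<n - 1]) \<and> w \<rightarrow>\<^bsub>T\<^esub> z ((n - 1) div 2) \<and>
        verts T - (z ` {1..n - 2} \<union> {w}) = {\<omega>} \<and> leaf T \<omega> \<and>
        (\<exists>j\<in>{2..n - 3}. \<omega> \<rightarrow>\<^bsub>T\<^esub> z j))"

end

theory Submission
  imports Defs
begin

text \<open>
  Let \<open>e\<close> and \<open>f\<close> be the eccentricities of \<open>u\<close> and \<open>w\<close>, let \<open>y\<close> be a vertex farthest from \<open>u\<close>,
  and let \<open>c\<close> be the neighbour of the leaf \<open>w\<close>. If \<open>w\<close> is \<open>u\<close> or \<open>y\<close>, then \<open>e \<le> f\<close>. Otherwise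
  every walk from \<open>w\<close> starts with the step to \<open>c\<close>, so the triangle inequality at \<open>c\<close> yields
  \<open>e + 2 \<le> d(w, u) + d(w, y) \<le> 2 f\<close>; moreover a shortest path from \<open>u\<close> to \<open>y\<close> avoids \<open>w\<close>, whence
  \<open>e + 2 \<le> n\<close>. The bound is then arithmetic, and for \<open>n \<ge> 6\<close> equality forces \<open>f = n div 2\<close> and
  \<open>e = 2 f - 2\<close>. In that case every vertex is within distance \<open>f - 1\<close> of \<open>c\<close>, so a path from \<open>u\<close>
  through \<open>c\<close> to \<open>y\<close> is a longest one and has its centre at \<open>c\<close>. Conversely, the centre of a
  longest path with \<open>2 k + 1\<close> vertices is within distance \<open>k\<close> of every vertex, which determines
  the eccentricity of a vertex attached to it.
\<close>

section \<open>Walks and paths as vertex lists\<close>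

lemma vwalk_iff_successively:
  "vwalk p G \<longleftrightarrow> p \<noteq> [] \<and> set p \<subseteq> verts G \<and> successively (dominates G) p"
proof -
  have "set (vwalk_arcs p) \<subseteq> arcs_ends G \<longleftrightarrow> successively (dominates G) p"
    by (induct p rule: vwalk_arcs.induct) auto
  then show ?thesis
    by (auto simp: vwalk_def)
qed

lemma vpath_iff_successively:
  "vpath p G \<longleftrightarrow> p \<noteq> [] \<and> set p \<subseteq> verts G \<and> successively (dominates G) p \<and> distinct p"
  by (auto simp: vpath_def vwalk_iff_successively)

lemma vwalk_nth_in_verts: "vwalk p G \<Longrightarrow> i < length p \<Longrightarrow> p ! i \<in> verts G"
  using nth_mem by (fastforce simp: vwalk_iff_successively)

lemma longest_pathD:
  assumes "longest_path G p"
  shows "vpath p G" "vwalk p G" "distinct p" "p \<noteq> []" and "vpath q G \<Longrightarrow> length q \<le> length p"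
proof -
  show p: "vpath p G" "vwalk p G" "distinct p" "p \<noteq> []"
    using assms by (auto simp: longest_path_def vpath_def vwalk_def)
  show "length q \<le> length p" if q: "vpath q G"
  proof -
    have "length q - 1 \<le> length p - 1"
      using assms q by (simp add: longest_path_def)
    \<comment> \<open>Path lengths are \<open>length\<close> minus one with truncated subtraction,
      so this is what makes the comparison carry over to numbers of vertices.\<close>
    moreover have "0 < length p"
      using p by simp
    ultimately show ?thesis
      by linarith
  qed
qed

text \<open>The list is the segment of \<open>p\<close> from index \<open>i\<close> to index
  \<open>j\<close>, both included, hence the \<open>Suc\<close>.\<close>

lemma vwalk_take_drop:
  assumes "vwalk p G" and "i \<le> j" and "j < length p"
  shows "vwalk (take (Suc (j - i)) (drop i p)) G"
    and "hd (take (Suc (j - i)) (drop i p)) = p ! i"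
    and "last (take (Suc (j - i)) (drop i p)) = p ! j"
    and "length (take (Suc (j - i)) (drop i p)) = Suc (j - i)"
proof -
  let ?q = "take (Suc (j - i)) (drop i p)"
  have ne: "?q \<noteq> []"
    using assms by auto
  have "vwalk (drop i p) G"
    using assms vwalkI_append_r[of "drop i p" "take i p" G] by simp
  then show "vwalk ?q G"
    using vwalkI_append_l[OF ne, of "drop (Suc (j - i)) (drop i p)"] by (simp only: append_take_drop_id)
  show len: "length ?q = Suc (j - i)"
    using assms by auto
  show "hd ?q = p ! i"
    using assms by (simp add: hd_conv_nth)
  have "last ?q = ?q ! (j - i)"
    using ne len by (subst last_conv_nth) auto
  then show "last ?q = p ! j"
    using assms by simp
qed

section \<open>Arc walks versus vertex walks, and a distance in the natural numbers\<close>

context wf_digraph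
begin

text \<open>With its counterpart \<open>vwalk_imp_awalk\<close>, this links the arc lists behind
  \<open>\<mu>\<close> and \<open>cycle\<close> to the vertex lists used for paths.\<close>

lemma vwalk_awalk_verts:
  assumes "awalk u es v"
  shows "vwalk (awalk_verts u es) G"
  using assms
proof (induct es arbitrary: u)
  case (Cons e es)
  then have "vwalk (awalk_verts (head G e) es) G" "awalk (head G e) es v" "e \<in> arcs G"
    by (auto simp: awalk_Cons_iff)
  then show ?case
    using in_arcs_imp_in_arcs_ends[of e] by (auto intro: vwalk_wf_digraph_consI)
qed (auto simp: awalk_Nil_iff vwalk_iff_successively)

lemma vwalk_imp_awalk:
  assumes "vwalk p G"
  shows "\<exists>es. awalk (hd p) es (last p) \<and> awalk_verts (hd p) es = p"
  using assms
proof (induct p rule: vwalk_induct)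
  case (Base u)
  then show ?case
    by (intro exI[of _ "[]"]) (auto simp: awalk_Nil_iff)
next
  case (Cons u v es)
  then obtain as where as: "awalk v as (last (v # es))" "awalk_verts v as = v # es"
    by auto
  obtain e where "e \<in> arcs G" "tail G e = u" "head G e = v"
    using Cons(1) by (auto simp: arcs_ends_conv)
  with as show ?case
    by (intro exI[of _ "e # as"]) (auto simp: awalk_Cons_iff)
qed

text \<open>A natural-number form of \<open>vdist\<close>, suited to linear arithmetic. The
  \<open>LEAST\<close> is meaningful only if some walk exists, which connectedness will
  guarantee.\<close>

definition gdist :: "'a \<Rightarrow> 'a \<Rightarrow> nat" where
  "gdist a b = (LEAST n. \<exists>p. vwalk p G \<and> hd p = a \<and> last p = b \<and> length p = Suc n)"

lemma gdist_le:
  assumes "vwalk p G"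
  shows "gdist (hd p) (last p) \<le> length p - 1"
proof -
  have "length p = Suc (length p - 1)"
    using assms by (auto simp: vwalk_iff_successively)
  then show ?thesis
    unfolding gdist_def using assms by (intro Least_le) blast
qed

end

section \<open>Distances in connected graphs\<close>

locale connected_graph = graph +
  assumes connected: "Digraph_Component.connected G"
begin

lemma dominates_sym: "a \<rightarrow>\<^bsub>G\<^esub> b \<longleftrightarrow> b \<rightarrow>\<^bsub>G\<^esub> a"
  using arcs_ends_symmetric[OF sym_arcs, of a b] arcs_ends_symmetric[OF sym_arcs, of b a]
  by (rule iffI)

lemma vwalk_rev: "vwalk (rev p) G \<longleftrightarrow> vwalk p G"
proof -
  have "(\<lambda>x y. y \<rightarrow>\<^bsub>G\<^esub> x) = (\<lambda>x y. x \<rightarrow>\<^bsub>G\<^esub> y)"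
    using dominates_sym by blast
  then show ?thesis
    by (simp only: vwalk_iff_successively successively_rev set_rev rev_is_Nil_conv)
qed

lemma ex_awalk:
  assumes "a \<in> verts G" "b \<in> verts G"
  shows "\<exists>es. awalk a es b"
proof -
  have "strongly_connected G"
    using symmetric_connected_imp_strongly_connected sym_arcs connected by blast
  then show ?thesis
    using assms by (auto simp: strongly_connected_def reachable_awalk)
qed

lemma shortest_vwalk:
  assumes "a \<in> verts G" "b \<in> verts G"
  shows "\<exists>p. vwalk p G \<and> hd p = a \<and> last p = b \<and> length p = Suc (gdist a b)"
proof -
  obtain es where es: "awalk a es b"
    using ex_awalk assms by blast
  have "\<exists>n p. vwalk p G \<and> hd p = a \<and> last p = b \<and> length p = Suc n"
    using es vwalk_awalk_verts[OF es]
    by (intro exI[of _ "length es"] exI[of _ "awalk_verts a es"]) (auto simp: length_awalk_verts)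
  then show ?thesis
    unfolding gdist_def by (rule LeastI_ex)
qed

text \<open>With unit weights the cost of a walk is its number of arcs. A shortest vertex walk
  bounds the infimum \<open>\<mu>\<close> from above, and each arc walk, read as a vertex walk, has
  at least \<open>gdist a b\<close> arcs.\<close>

lemma vdist_eq_gdist:
  assumes "a \<in> verts G" "b \<in> verts G"
  shows "vdist G a b = real (gdist a b)"
proof -
  have cost: "awalk_cost (\<lambda>_. 1) es = real (length es)" for es
    by (induct es) auto
  have "\<mu> (\<lambda>_. 1) a b = ereal (real (gdist a b))"
  proof (rule antisym)
    obtain p where p: "vwalk p G" "hd p = a" "last p = b" "length p = Suc (gdist a b)"
      using shortest_vwalk assms by blast
    then obtain es where es: "awalk a es b" "awalk_verts a es = p"
      using vwalk_imp_awalk by blast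
    then have "length es = gdist a b"
      using p(4) length_awalk_verts[of a es] by simp
    then show "\<mu> (\<lambda>_. 1) a b \<le> ereal (real (gdist a b))"
      using min_cost_le_walk_cost[OF es(1), of "\<lambda>_. 1"] by (simp add: cost)
  next
    have "gdist a b \<le> length es" if "awalk a es b" for es
      using gdist_le[OF vwalk_awalk_verts[OF that]] that by (simp add: length_awalk_verts)
    then show "ereal (real (gdist a b)) \<le> \<mu> (\<lambda>_. 1) a b"
      unfolding \<mu>_def by (intro INF_greatest) (simp add: cost)
  qed
  then show ?thesis
    by (simp add: vdist_def)
qed

lemma gdist_sym:
  assumes "a \<in> verts G" "b \<in> verts G"
  shows "gdist a b = gdist b a"
proof -
  have "gdist b a \<le> gdist a b" if ab: "a \<in> verts G" "b \<in> verts G" for a b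
  proof -
    obtain p where p: "vwalk p G" "hd p = a" "last p = b" "length p = Suc (gdist a b)"
      using shortest_vwalk ab by blast
    then show ?thesis
      using gdist_le[of "rev p"] by (simp add: vwalk_rev hd_rev last_rev)
  qed
  then show ?thesis
    using assms by (simp add: antisym)
qed

lemma gdist_triangle:
  assumes "a \<in> verts G" "b \<in> verts G" "c \<in> verts G"
  shows "gdist a c \<le> gdist a b + gdist b c"
proof -
  obtain p where p: "vwalk p G" "hd p = a" "last p = b" "length p = Suc (gdist a b)"
    using shortest_vwalk assms by blast
  obtain q where q: "vwalk q G" "hd q = b" "last q = c" "length q = Suc (gdist b c)"
    using shortest_vwalk assms by blast
  have j: "joinable p q"
    using p q by (auto simp: joinable_def vwalk_iff_successively)
  have "length (p \<oplus> q) - 1 = gdist a b + gdist b c"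
    using p q by (simp add: vwalk_join_def)
  then show ?thesis
    using gdist_le[OF vwalk_joinI_vwalk[OF p(1) q(1) j]] j p q
    by (simp add: vwalk_join_hd vwalk_join_last)
qed

lemma gdist_dominates:
  assumes "a \<rightarrow>\<^bsub>G\<^esub> b"
  shows "gdist a b \<le> 1"
proof -
  have "vwalk [a, b] G"
    using assms by (auto simp: vwalk_iff_successively adj_in_verts)
  from gdist_le[OF this] show ?thesis
    by simp
qed

lemma gdist_nth_le:
  assumes "vwalk p G" "i \<le> j" "j < length p"
  shows "gdist (p ! i) (p ! j) \<le> j - i"
  using gdist_le[OF vwalk_take_drop(1)[OF assms]]
  by (simp only: vwalk_take_drop(2-4)[OF assms] diff_Suc_1)

text \<open>A vertex repeated at positions \<open>i < j\<close> of a shortest walk would allow a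
  shortcut, against the triangle inequality.\<close>

lemma shortest_vpath:
  assumes "a \<in> verts G" "b \<in> verts G"
  shows "\<exists>p. vpath p G \<and> hd p = a \<and> last p = b \<and> length p = Suc (gdist a b)"
proof -
  obtain p where p: "vwalk p G" "hd p = a" "last p = b" "length p = Suc (gdist a b)"
    using shortest_vwalk assms by blast
  note verts = vwalk_nth_in_verts[OF p(1)]
  have hl: "p ! 0 = a" "p ! gdist a b = b"
    using p by (auto simp: hd_conv_nth last_conv_nth vwalk_iff_successively)
  have "p ! i \<noteq> p ! j" if "i < j" "j < length p" for i j
  proof
    assume eq: "p ! i = p ! j"
    have "gdist a (p ! i) \<le> i"
      using gdist_nth_le[OF p(1), of 0 i] that hl by simp
    moreover have "gdist (p ! i) b \<le> gdist a b - j"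
      using gdist_nth_le[OF p(1), of j "gdist a b"] that hl p(4) eq by simp
    moreover have "gdist a b \<le> gdist a (p ! i) + gdist (p ! i) b"
      using assms verts that by (intro gdist_triangle) auto
    ultimately show False
      using that p(4) by linarith
  qed
  then have "distinct p"
    by (metis distinct_conv_nth nat_neq_iff)
  with p show ?thesis
    by (auto simp: vpath_def)
qed

section \<open>Leaves and eccentricities\<close>

lemma leaf_ex1_dominates:
  assumes "v \<in> verts G"
  shows "leaf G v \<longleftrightarrow> (\<exists>!c. v \<rightarrow>\<^bsub>G\<^esub> c)"
proof -
  \<comment> \<open>Without parallel arcs, counting outgoing arcs is counting neighbours.\<close>
  have "inj_on (head G) (out_arcs G v)"
    by (rule inj_onI, rule no_multi_arcs) (auto simp: arc_to_ends_def)
  then have "out_degree G v = card (head G ` out_arcs G v)"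
    by (simp add: out_degree_def card_image)
  also have "head G ` out_arcs G v = {c. v \<rightarrow>\<^bsub>G\<^esub> c}"
    by (auto simp: arcs_ends_conv)
  finally have "leaf G v \<longleftrightarrow> card {c. v \<rightarrow>\<^bsub>G\<^esub> c} = 1"
    using assms by (simp add: leaf_def)
  also have "\<dots> \<longleftrightarrow> (\<exists>c. {c. v \<rightarrow>\<^bsub>G\<^esub> c} = {c})"
    by (simp add: card_1_singleton_iff)
  also have "\<dots> \<longleftrightarrow> (\<exists>!c. v \<rightarrow>\<^bsub>G\<^esub> c)"
    unfolding set_eq_iff mem_Collect_eq singleton_iff by metis
  finally show ?thesis .
qed

text \<open>A walk from \<open>w\<close> to another vertex must step to \<open>c\<close> first;
  deleting \<open>w\<close> from it leaves a walk from \<open>c\<close>.\<close>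

lemma gdist_leaf:
  assumes "leaf G w" "w \<rightarrow>\<^bsub>G\<^esub> c" "x \<in> verts G" "x \<noteq> w"
  shows "gdist w x = Suc (gdist c x)"
proof (rule antisym)
  have w: "w \<in> verts G" "c \<in> verts G"
    using assms adj_in_verts by auto
  show "gdist w x \<le> Suc (gdist c x)"
    using gdist_triangle[of w c x] gdist_dominates[OF assms(2)] w assms(3) by simp
  obtain p where p: "vwalk p G" "hd p = w" "last p = x" "length p = Suc (gdist w x)"
    using shortest_vwalk w assms by blast
  then obtain b q where q: "p = w # b # q"
    using assms(4) by (cases p; cases "tl p") (auto simp: vwalk_iff_successively)
  then have "w \<rightarrow>\<^bsub>G\<^esub> b"
    using p(1) by (auto simp: vwalk_iff_successively)
  then have "b = c"
    using assms(1,2) leaf_ex1_dominates[OF w(1)] by blast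
  moreover have "vwalk (b # q) G"
    using p(1) q by (auto simp: vwalk_iff_successively)
  ultimately show "Suc (gdist c x) \<le> gdist w x"
    using gdist_le[of "b # q"] p q by simp
qed

definition gecc :: "'a \<Rightarrow> nat" where
  "gecc v = Max (gdist v ` verts G)"

lemma gdist_le_gecc: "x \<in> verts G \<Longrightarrow> gdist v x \<le> gecc v"
  by (simp add: gecc_def)

lemma gecc_attained:
  assumes "v \<in> verts G"
  shows "\<exists>y\<in>verts G. gdist v y = gecc v"
proof -
  have "gecc v \<in> gdist v ` verts G"
    unfolding gecc_def using assms by (intro Max_in) auto
  then show ?thesis
    by auto
qed

lemma ecc_eq_gecc:
  assumes "v \<in> verts G"
  shows "ecc G v = real (gecc v)"
proof -
  have "vdist G v ` verts G = real ` gdist v ` verts G"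
    using assms by (simp add: image_image vdist_eq_gdist)
  moreover have "real (gecc v) = Max (real ` gdist v ` verts G)"
    unfolding gecc_def using assms by (intro mono_Max_commute) (auto intro: monoI)
  ultimately show ?thesis
    by (simp add: ecc_def)
qed

lemma gecc_leaf_cases:
  assumes "leaf G u" "leaf G w"
  shows "gecc u \<le> gecc w \<or> gecc u + 2 \<le> 2 * gecc w \<and> gecc u + 2 \<le> card (verts G)"
proof -
  have uw: "u \<in> verts G" "w \<in> verts G"
    using assms by (auto simp: leaf_def)
  obtain y where y: "y \<in> verts G" "gdist u y = gecc u"
    using gecc_attained uw by blast
  obtain c where c: "w \<rightarrow>\<^bsub>G\<^esub> c"
    using assms(2) leaf_ex1_dominates[OF uw(2)] by blast
  then have cv: "c \<in> verts G"
    using adj_in_verts by auto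
  show ?thesis
  proof (cases "w = u \<or> w = y")
    case True
    then have "gecc u \<le> gecc w"
      using y uw gdist_sym[of u y] gdist_le_gecc[of u w] by auto
    then show ?thesis ..
  next
    case False
    \<comment> \<open>Both distances contain the edge between \<open>w\<close> and \<open>c\<close>,
      which accounts for the 2; the rest is the triangle inequality at \<open>c\<close>.\<close>
    have sum: "gdist u w + gdist w y \<ge> gecc u + 2"
      using gdist_leaf[OF assms(2) c, of u] gdist_leaf[OF assms(2) c, of y]
        gdist_triangle[of u c y] gdist_sym[of u c] gdist_sym[of u w] uw y cv False by auto
    have "gecc u + 2 \<le> 2 * gecc w"
      using sum gdist_le_gecc[of u w] gdist_le_gecc[of y w] gdist_sym[of u w] uw y by auto
    moreover have "gecc u + 2 \<le> card (verts G)"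
    proof -
      obtain p where p: "vpath p G" "hd p = u" "last p = y" "length p = Suc (gecc u)"
        using shortest_vpath uw y by metis
      have vw: "vwalk p G" "distinct p" "p \<noteq> []"
        using p(1) by (auto simp: vpath_iff_successively vwalk_iff_successively)
      \<comment> \<open>If \<open>w\<close> were on this shortest path, its distances to
        \<open>u\<close> and \<open>y\<close> would add up to at most \<open>gecc u\<close>, against
        \<open>sum\<close>.\<close>
      have "w \<notin> set p"
      proof
        assume "w \<in> set p"
        then obtain i where i: "i < length p" "p ! i = w"
          by (auto simp: in_set_conv_nth)
        then show False
          using gdist_nth_le[OF vw(1), of 0 i] gdist_nth_le[OF vw(1), of i "gecc u"] sum p vw
          by (simp add: hd_conv_nth last_conv_nth)
      qed
      then have "card (insert w (set p)) = gecc u + 2"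
        using vw p(4) by (simp add: distinct_card)
      moreover have "insert w (set p) \<subseteq> verts G"
        using vw uw by (auto simp: vwalk_iff_successively)
      ultimately show ?thesis
        using card_mono[OF finite_verts] by metis
    qed
    ultimately show ?thesis by simp
  qed
qed

end

section \<open>Trees: unique paths and longest paths\<close>

locale undirected_tree_graph = connected_graph +
  assumes acyclic: "cycle es \<Longrightarrow> length es < 3"
begin

text \<open>
  If the paths part at their first step, they close up to a cycle \<open>?c\<close> where they first meet again.
\<close>
lemma unique_vpath:
  assumes "vpath p G" "vpath q G" "hd p = hd q" "last p = last q"
  shows "p = q"
  using assms
proof (induct p arbitrary: q)
  case (Cons a p)
  then obtain q' where q: "q = a # q'"
    by (cases q) (auto simp: vpath_iff_successively)
  show ?case
  proof (cases "p = [] \<or> q' = []")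
    case True
    then show ?thesis
      using Cons.prems q
      by (metis distinct.simps(2) last.simps last_in_set vpath_iff_successively)
  next
    case False
    then have dis: "a \<notin> set p" "a \<notin> set q'" "distinct p" "distinct q'"
      and wp: "vwalk p G" "vwalk q' G" and adj: "a \<rightarrow>\<^bsub>G\<^esub> hd p" "a \<rightarrow>\<^bsub>G\<^esub> hd q'"
      and lst: "last p = last q'" and av: "a \<in> verts G"
      using Cons.prems q
      by (auto simp: vpath_iff_successively vwalk_iff_successively successively_Cons)
    have "hd p = hd q'"
    proof (rule ccontr)
      assume ne: "hd p \<noteq> hd q'"
      have "\<exists>x\<in>set q'. x \<in> set p"
        using lst False by (metis last_in_set)
      \<comment> \<open>Taking the first vertex of \<open>q'\<close> on \<open>p\<close> keeps
        \<open>qs\<close> disjoint from \<open>p\<close>, so that \<open>?c\<close> repeats only its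
        end \<open>a\<close>.\<close>
      then obtain qs v qr where qs: "q' = qs @ v # qr" "v \<in> set p" "\<forall>x\<in>set qs. x \<notin> set p"
        using split_list_first_prop[of q' "\<lambda>x. x \<in> set p"] by blast
      obtain ps pr where ps: "p = ps @ v # pr"
        using qs(2) split_list by fast
      let ?c = "a # ps @ v # rev qs @ [a]"
      have "vwalk (a # ps @ [v]) G"
        using av wp(1) adj(1) ps
        by (auto simp: vwalk_iff_successively successively_Cons successively_append_iff hd_append)
      moreover have "vwalk (a # qs @ [v]) G"
        using av wp(2) adj(2) qs(1)
        by (auto simp: vwalk_iff_successively successively_Cons successively_append_iff hd_append)
      then have "vwalk (v # rev qs @ [a]) G"
        using vwalk_rev[of "a # qs @ [v]"] by simp
      ultimately have "vwalk ((a # ps @ [v]) \<oplus> (v # rev qs @ [a])) G"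
        by (intro vwalk_joinI_vwalk) auto
      then have "vwalk ?c G"
        by (simp add: vwalk_join_def)
      then obtain es where es: "awalk a es a" "awalk_verts a es = ?c"
        using vwalk_imp_awalk[of ?c] by auto
      have "distinct (tl ?c)"
        using dis ps qs by auto
      moreover have "ps \<noteq> [] \<or> qs \<noteq> []"
        using ne ps qs(1) by auto
      \<comment> \<open>Since the second vertices differ, \<open>ps\<close> and \<open>qs\<close>
        are not both empty, so \<open>?c\<close> has at least four entries.\<close>
      then have "3 \<le> length es"
        using es(2) length_awalk_verts[of a es] by (cases ps; cases qs) auto
      ultimately show False
        using acyclic[of es] es unfolding cycle_def by (metis list.size(3) not_le not_numeral_le_zero)
    qed
    then have "p = q'"
      using dis wp lst by (intro Cons.hyps) (auto simp: vpath_def)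
    then show ?thesis
      using q by simp
  qed
qed (simp add: vpath_iff_successively)

text \<open>By uniqueness, every path of a tree is the shortest path between its ends.\<close>

lemma length_vpath:
  assumes "vpath p G"
  shows "length p = Suc (gdist (hd p) (last p))"
proof -
  have "hd p \<in> verts G" "last p \<in> verts G"
    using assms by (auto simp: vpath_iff_successively)
  then show ?thesis
    using shortest_vpath unique_vpath assms by metis
qed

lemma gdist_nth:
  assumes "vpath p G" "i \<le> j" "j < length p"
  shows "gdist (p ! i) (p ! j) = j - i"
proof -
  have p: "vwalk p G" "distinct p"
    using assms by (auto simp: vpath_def)
  have "vpath (take (Suc (j - i)) (drop i p)) G"
    using vwalk_take_drop(1)[OF p(1) assms(2,3)] p(2) by (simp add: vpath_def)
  from length_vpath[OF this] show ?thesis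
    by (simp only: vwalk_take_drop(2-4)[OF p(1) assms(2,3)])
qed

text \<open>
  A path from the centre to \<open>x\<close> leaves the longest path at some vertex \<open>v\<close> for good; its remainder
  extends both halves into which \<open>v\<close> cuts the longest path, so it is no longer than either of them.
\<close>
lemma longest_path_centre:
  assumes "longest_path G p" "length p = 2 * k + 1" "x \<in> verts G"
  shows "gdist (p ! k) x \<le> k"
proof -
  note p = longest_pathD(1-4)[OF assms(1)]
    and longest = longest_pathD(5)[OF assms(1), unfolded assms(2)]
  note verts = vwalk_nth_in_verts[OF p(2)]
  have c: "p ! k \<in> set p" "p ! k \<in> verts G"
    using assms(2) verts by auto
  obtain q where q: "vpath q G" "hd q = p ! k" "last q = x"
    using shortest_vpath assms(3) c by blast
  then have "\<exists>v\<in>set q. v \<in> set p"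
    using c by (metis hd_in_set vpath_iff_successively)
  then obtain q1 v q2 where q12: "q = q1 @ v # q2" "v \<in> set p" "\<forall>y\<in>set q2. y \<notin> set p"
    using split_list_last_prop[of q "\<lambda>x. x \<in> set p"] by blast
  then obtain i where i: "i < length p" "p ! i = v"
    by (auto simp: in_set_conv_nth)
  have vq: "vwalk (v # q2) G" "distinct q2"
    using q(1) q12(1) vwalkI_append_r[of "v # q2" q1 G] by (auto simp: vpath_def)
  have "vpath (take (Suc i) p \<oplus> v # q2) G"
  proof
    have "vwalk (take (Suc i) p) G" "last (take (Suc i) p) = v"
      using vwalk_take_drop(1,3)[OF p(2), of 0 i] i by simp_all
    then show "vwalk (take (Suc i) p \<oplus> v # q2) G"
      using vq by (intro vwalk_joinI_vwalk') auto
    show "distinct (take (Suc i) p \<oplus> v # q2)"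
      using p(3) vq q12(3) by (auto simp: vwalk_join_def dest: in_set_takeD)
  qed
  from longest[OF this] have 1: "i + length q2 \<le> 2 * k"
    using i by (simp add: vwalk_join_def)
  have "vpath (rev (drop i p) \<oplus> v # q2) G"
  proof
    have "vwalk (drop i p) G" "hd (drop i p) = v"
      using vwalkI_append_r[of "drop i p" "take i p" G] i p(2) by (simp_all add: hd_drop_conv_nth)
    then show "vwalk (rev (drop i p) \<oplus> v # q2) G"
      using vq by (intro vwalk_joinI_vwalk') (auto simp: vwalk_rev last_rev)
    show "distinct (rev (drop i p) \<oplus> v # q2)"
      using p(3) vq q12(3) by (auto simp: vwalk_join_def dest: in_set_dropD)
  qed
  from longest[OF this] have 2: "length q2 \<le> i"
    using i assms(2) by (simp add: vwalk_join_def)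
  have vv: "v \<in> verts G"
    using verts i by blast
  have "gdist (p ! k) v \<le> (if i \<le> k then k - i else i - k)"
    using gdist_nth_le[OF p(2), of i k] gdist_nth_le[OF p(2), of k i] i assms(2)
      gdist_sym[OF vv c(2)] by auto
  moreover have "gdist v x \<le> length q2"
    using gdist_le[OF vq(1)] q(3) q12(1) by simp
  moreover have "gdist (p ! k) x \<le> gdist (p ! k) v + gdist v x"
    using gdist_triangle c(2) vv assms(3) by blast
  \<comment> \<open>For \<open>i \<le> k\<close> fact \<open>2\<close> gives at most
    \<open>(k - i) + i\<close>; for \<open>i > k\<close> fact \<open>1\<close> gives at most
    \<open>(i - k) + (2 * k - i)\<close>.\<close>
  ultimately show ?thesis
    using 1 2 by (auto split: if_splits)
qed

text \<open>This evaluates both eccentricities in an extremal configuration. For \<open>w\<close>,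
  the upper bound is one step to the centre plus the radius \<open>k\<close>; the lower bound comes
  from an end of \<open>p\<close>, with \<open>w\<close> off or on the path.\<close>

lemma gecc_extremal:
  assumes "longest_path G p" "length p = 2 * k + 1" "w \<rightarrow>\<^bsub>G\<^esub> p ! k"
  shows "gecc (hd p) = 2 * k" and "gecc w = k + 1"
proof -
  note p = longest_pathD(1-4)[OF assms(1)]
    and longest = longest_pathD(5)[OF assms(1), unfolded assms(2)]
  note verts = vwalk_nth_in_verts[OF p(2)]
  have hdlast: "hd p = p ! 0" "last p = p ! (2 * k)"
    using p(4) assms(2) by (auto simp: hd_conv_nth last_conv_nth)
  have hv: "hd p \<in> verts G" and lv: "last p \<in> verts G"
    using hdlast verts assms(2) by auto
  obtain y where y: "y \<in> verts G" "gdist (hd p) y = gecc (hd p)"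
    using gecc_attained[OF hv] by blast
  have "gecc (hd p) \<le> 2 * k"
    using shortest_vpath[OF hv y(1)] y(2) longest by fastforce
  then show "gecc (hd p) = 2 * k"
    using gdist_le_gecc[OF lv, of "hd p"] length_vpath[OF p(1)] assms(2) by simp
  have wv: "w \<in> verts G" and cv: "p ! k \<in> verts G"
    using adj_in_verts[OF assms(3)] by auto
  obtain x where x: "x \<in> verts G" "gdist w x = gecc w"
    using gecc_attained[OF wv] by blast
  have upper: "gecc w \<le> k + 1"
    using gdist_triangle[OF wv cv x(1)] gdist_dominates[OF assms(3)]
      longest_path_centre[OF assms(1,2) x(1)] x(2) by simp
  have "k + 1 \<le> gdist w (hd p) \<or> k + 1 \<le> gdist w (last p)"
  proof (cases "w \<in> set p")
    case False
    have d: "vwalk (drop k p) G" "hd (drop k p) = p ! k"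
      using vwalkI_append_r[of "drop k p" "take k p" G] assms(2) p(2) by (simp_all add: hd_drop_conv_nth)
    have "vpath (w # drop k p) G"
      using False p(3) d assms(3) vwalk_wf_digraph_consI[of "drop k p" w]
      by (auto simp: vpath_def dest: in_set_dropD)
    from length_vpath[OF this] have "k + 1 = gdist w (last p)"
      using assms(2) by simp
    then show ?thesis by simp
  next
    case True
    then obtain i where i: "i < length p" "p ! i = w"
      by (auto simp: in_set_conv_nth)
    have ne: "i \<noteq> k"
      using assms(3) i adj_not_same by blast
    have "gdist w (hd p) = i"
      using gdist_nth[OF p(1), of 0 i] gdist_sym[OF wv hv] i hdlast by simp
    moreover have "gdist w (last p) = 2 * k - i"
      using gdist_nth[OF p(1), of i "2 * k"] i hdlast assms(2) by simp
    ultimately show ?thesis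
      using ne by linarith
  qed
  then show "gecc w = k + 1"
    using upper gdist_le_gecc[OF hv, of w] gdist_le_gecc[OF lv, of w] by linarith
qed

lemma extremal_path:
  assumes "leaf G u" "leaf G w" "gecc u = 2 * k" "gecc w = k + 1" "2 \<le> k"
  shows "\<exists>p. longest_path G p \<and> length p = 2 * k + 1 \<and> hd p = u \<and> w \<rightarrow>\<^bsub>G\<^esub> p ! k \<and> w \<notin> set p"
proof -
  have uv: "u \<in> verts G" and wv: "w \<in> verts G"
    using assms by (auto simp: leaf_def)
  obtain y where y: "y \<in> verts G" "gdist u y = 2 * k"
    using gecc_attained uv assms(3) by metis
  obtain c where c: "w \<rightarrow>\<^bsub>G\<^esub> c"
    using assms(2) leaf_ex1_dominates[OF wv] by blast
  then have cv: "c \<in> verts G"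
    using adj_in_verts by auto
  have radius: "gdist c x \<le> k" if x: "x \<in> verts G" for x
  proof (cases "x = w")
    case True
    then show ?thesis
      using gdist_dominates[of c w] c dominates_sym assms(5) by fastforce
  next
    case False
    then show ?thesis
      using gdist_leaf[OF assms(2) c x] gdist_le_gecc[OF x, of w] assms(4) by simp
  qed
  \<comment> \<open>Both distances are at most \<open>k\<close>, while their sum is at least
    \<open>2 * k\<close>.\<close>
  have eq: "gdist u c = k" "gdist c y = k"
    using radius[OF uv] radius[OF y(1)] gdist_triangle[OF uv cv y(1)] gdist_sym[OF uv cv] y(2) by auto
  \<comment> \<open>Here \<open>k \<ge> 2\<close> matters: it makes \<open>2 * k\<close> larger than
    \<open>k + 1\<close>.\<close>
  have far: "w \<noteq> u" "w \<noteq> y"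
    using assms(3-5) y gdist_sym[OF uv wv] gdist_le_gecc[OF uv, of w] by auto
  obtain p where p: "vpath p G" "hd p = u" "last p = c" "length p = k + 1"
    using shortest_vpath[OF uv cv] eq by auto
  obtain q where q: "vpath q G" "hd q = c" "last q = y" "length q = k + 1"
    using shortest_vpath[OF cv y(1)] eq by auto
  have pw: "vwalk p G" "vwalk q G" "p \<noteq> []" "q \<noteq> []" "distinct p" "distinct q"
    using p(1) q(1) by (auto simp: vpath_iff_successively vwalk_iff_successively)
  have j: "joinable p q"
    using p q pw by simp
  let ?r = "p \<oplus> q"
  have "p ! k = c"
    using p(3,4) pw(3) by (simp add: last_conv_nth)
  then have "?r ! k = c"
    using p(4) by (simp add: vwalk_join_def nth_append)
  then have rw: "vwalk ?r G" "hd ?r = u" "last ?r = y" "length ?r = 2 * k + 1" "?r ! k = c"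
    using vwalk_joinI_vwalk[OF pw(1,2) j] p(2,4) q(3,4) by (simp_all add: vwalk_join_hd[OF j] vwalk_join_last[OF j])
      (simp add: vwalk_join_def)
  have "?r \<noteq> []"
    using pw(3) by simp
  then have ends: "?r ! 0 = u" "?r ! (2 * k) = y"
    using rw(2-4) by (simp_all add: hd_conv_nth last_conv_nth)
  have through: "gdist u (?r ! i) \<le> i \<and> gdist (?r ! i) y \<le> 2 * k - i" if "i < length ?r" for i
    using gdist_nth_le[OF rw(1), of 0 i] gdist_nth_le[OF rw(1), of i "2 * k"] that rw(4) ends
    by simp
  have "?r ! i \<noteq> ?r ! j" if "i < j" "j < length ?r" for i j
  proof
    assume eq: "?r ! i = ?r ! j"
    have "?r ! i \<in> verts G"
      using vwalk_nth_in_verts[OF rw(1)] that by simp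
    then have "2 * k \<le> gdist u (?r ! i) + gdist (?r ! i) y"
      using gdist_triangle[OF uv _ y(1), of "?r ! i"] y(2) by simp
    moreover have "gdist u (?r ! i) \<le> i" "gdist (?r ! i) y \<le> 2 * k - j"
      using through[of i] through[of j] eq that by simp_all
    ultimately show False
      using that rw(4) by linarith
  qed
  then have "distinct ?r"
    by (metis distinct_conv_nth nat_neq_iff)
  then have r: "vpath ?r G"
    using rw(1) by (simp add: vpath_def)
  \<comment> \<open>Both ends of any path are within \<open>k\<close> of \<open>c\<close>, and its
    length is the distance of its ends.\<close>
  have "length q' \<le> 2 * k + 1" if q': "vpath q' G" for q'
  proof -
    have "hd q' \<in> verts G" "last q' \<in> verts G"
      using q' by (auto simp: vpath_iff_successively)
    then show ?thesis
      using length_vpath[OF q'] gdist_triangle[of "hd q'" c "last q'"] radius[of "hd q'"]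
        radius[of "last q'"] gdist_sym[of "hd q'" c] cv by simp
  qed
  then have "longest_path G ?r"
    using r rw(4) by (fastforce simp: longest_path_def)
  moreover have "w \<notin> set ?r"
  proof
    assume "w \<in> set ?r"
    then obtain i where i: "i < length ?r" "?r ! i = w"
      by (auto simp: in_set_conv_nth)
    \<comment> \<open>As a leaf at \<open>c\<close>, \<open>w\<close> has distance
      \<open>k + 1\<close> from both \<open>u\<close> and \<open>y\<close>.\<close>
    have "Suc k \<le> i \<and> Suc k \<le> 2 * k - i"
      using through[OF i(1)] i(2) gdist_leaf[OF assms(2) c uv] gdist_leaf[OF assms(2) c y(1)]
        far eq gdist_sym[OF uv wv] gdist_sym[OF uv cv] by simp
    then show False
      by auto
  qed
  ultimately show ?thesis
    using rw(2,4,5) c by (intro exI[of _ ?r]) simp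
qed

text \<open>A neighbour at an end of \<open>p\<close> would prolong it, and two neighbours on
  \<open>p\<close> would close a cycle. This handles the remaining vertex in the odd case.\<close>

lemma leaf_off_longest_path:
  assumes "longest_path G p" "2 \<le> length p" "x \<in> verts G" "x \<notin> set p"
    and nbrs: "\<And>v. x \<rightarrow>\<^bsub>G\<^esub> v \<Longrightarrow> v \<in> set p"
  shows "leaf G x" and "\<exists>i. 0 < i \<and> i + 1 < length p \<and> x \<rightarrow>\<^bsub>G\<^esub> p ! i"
proof -
  note p = longest_pathD(1-4)[OF assms(1)] and longest = longest_pathD(5)[OF assms(1)]
  have "hd p \<in> verts G"
    using p by (auto simp: vwalk_iff_successively)
  then obtain q where q: "vpath q G" "hd q = x" "last q = hd p"
    using shortest_vpath[OF assms(3)] by blast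
  obtain v where v: "x \<rightarrow>\<^bsub>G\<^esub> v"
    using q assms(4) p(4)
    by (cases q rule: vwalk_arcs.cases) (auto simp: vpath_iff_successively)
  obtain i where i: "i < length p" "p ! i = v"
    using nbrs[OF v] by (auto simp: in_set_conv_nth)
  have "i \<noteq> 0"
  proof
    assume "i = 0"
    then have "vpath (x # p) G"
      using i v p assms(4) vwalk_wf_digraph_consI[of p x] by (auto simp: vpath_def hd_conv_nth)
    from longest[OF this] show False by simp
  qed
  moreover have "i + 1 \<noteq> length p"
  proof
    assume "i + 1 = length p"
    then have "last p = v"
      using i p(4) by (metis add_diff_cancel_right' last_conv_nth)
    then have "vpath (x # rev p) G"
      using v p assms(4) vwalk_wf_digraph_consI[of "rev p" x]
      by (auto simp: vpath_def vwalk_rev hd_rev)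
    from longest[OF this] show False by simp
  qed
  ultimately show "\<exists>i. 0 < i \<and> i + 1 < length p \<and> x \<rightarrow>\<^bsub>G\<^esub> p ! i"
    using i v by (intro exI[of _ i]) auto
  \<comment> \<open>The detour from \<open>x\<close> along \<open>p\<close> from \<open>i\<close> to
    \<open>j\<close> is a path with at least two edges, although its ends are adjacent.\<close>
  have no_two: False if ij: "i < j" "j < length p" "x \<rightarrow>\<^bsub>G\<^esub> p ! i" "x \<rightarrow>\<^bsub>G\<^esub> p ! j" for i j
  proof -
    let ?s = "take (Suc (j - i)) (drop i p)"
    note s = vwalk_take_drop[OF p(2) less_imp_le[OF ij(1)] ij(2)]
    have "vpath (x # ?s) G"
      using s(1,2) p(3) assms(4) ij(3) vwalk_wf_digraph_consI[of ?s x]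
      by (auto simp: vpath_def dest!: in_set_takeD in_set_dropD)
    from length_vpath[OF this] have "gdist x (p ! j) = Suc (j - i)"
      using s(3,4) ij by (auto split: if_splits)
    then show False
      using gdist_dominates[OF ij(4)] ij(1) by simp
  qed
  have "v' = v" if v': "x \<rightarrow>\<^bsub>G\<^esub> v'" for v'
  proof -
    obtain j where "j < length p" "p ! j = v'"
      using nbrs[OF v'] by (auto simp: in_set_conv_nth)
    then show ?thesis
      using i no_two[of i j] no_two[of j i] v v' by (metis nat_neq_iff)
  qed
  then show "leaf G x"
    using leaf_ex1_dominates[OF assms(3)] v by blast
qed

end

section \<open>The numerical bound and the final assembly\<close>

lemma undirected_tree_iff: "undirected_tree T \<longleftrightarrow> undirected_tree_graph T"
  by (auto simp: undirected_tree_def undirected_tree_graph_def undirected_tree_graph_axioms_def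
      connected_graph_def connected_graph_axioms_def not_le)

text \<open>Clearing denominators turns both claims into statements about natural numbers. For
  \<open>n\<close> equal to 4 or 5 the bound is 1, which every \<open>e = f\<close> attains; hence
  the equality case starts at 6.\<close>

lemma ratio_bound:
  fixes e f n :: nat
  assumes "4 \<le> n" "0 < f" "e \<le> f \<or> e + 2 \<le> 2 * f \<and> e + 2 \<le> n"
  shows "real e / real f \<le> 2 - 2 / real (n div 2)"
    and "6 \<le> n \<Longrightarrow> real e / real f = 2 - 2 / real (n div 2) \<Longrightarrow> f = n div 2 \<and> e + 2 = 2 * f"
proof -
  define m where "m = n div 2"
  have m: "2 \<le> m" "n \<le> 2 * m + 1"
    using assms(1) by (auto simp: m_def)
  have frac: "real e / real f \<le> 2 - 2 / real m \<longleftrightarrow> e * m + 2 * f \<le> 2 * f * m"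
    "real e / real f = 2 - 2 / real m \<longleftrightarrow> e * m + 2 * f = 2 * f * m"
  proof -
    have "real e / real f \<le> 2 - 2 / real m \<longleftrightarrow> real (e * m + 2 * f) \<le> real (2 * f * m)"
      using m assms(2) by (simp add: field_simps)
    then show "real e / real f \<le> 2 - 2 / real m \<longleftrightarrow> e * m + 2 * f \<le> 2 * f * m"
      by (simp only: of_nat_le_iff)
    have "real e / real f = 2 - 2 / real m \<longleftrightarrow> real (e * m + 2 * f) = real (2 * f * m)"
      using m assms(2) by (simp add: field_simps)
    then show "real e / real f = 2 - 2 / real m \<longleftrightarrow> e * m + 2 * f = 2 * f * m"
      by (simp only: of_nat_eq_iff)
  qed
  obtain d where d: "m = d + 2"
    using m(1) le_Suc_ex by (metis add.commute)
  have main: "e * m + 2 * f \<le> 2 * f * m \<and> (3 \<le> m \<longrightarrow> e * m + 2 * f = 2 * f * m \<longrightarrow> f = m \<and> e + 2 = 2 * f)"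
  proof (cases "e \<le> f")
    case True
    have "e * m \<le> f * m"
      using True by simp
    moreover have "f * 2 \<le> f * m" "3 \<le> m \<Longrightarrow> f * 3 \<le> f * m"
      using m(1) by simp_all
    ultimately show ?thesis
      using assms(2) by linarith
  next
    case False
    then have ef: "e + 2 \<le> 2 * f" "e + 2 \<le> 2 * m + 1"
      using assms(3) m(2) by auto
    show ?thesis
    proof (cases "f \<le> m")
      case True
      \<comment> \<open>This gives \<open>e * m + 2 * f \<le> e * m + 2 * m \<le> 2 * f * m\<close>,
        and equality forces \<open>f = m\<close>.\<close>
      have "(e + 2) * m \<le> 2 * f * m"
        using ef(1) by (rule mult_le_mono1)
      moreover have "(e + 2) * m = e * m + 2 * m"
        by (simp add: algebra_simps)
      moreover have "e + 2 = 2 * f" if "e * m + 2 * f = 2 * f * m" "f = m"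
      proof -
        have "(e + 2) * m = 2 * f * m"
          using that by (simp add: algebra_simps)
        then show ?thesis
          using m(1) by (metis mult_cancel2 not_numeral_le_zero)
      qed
      ultimately show ?thesis
        using True by linarith
    next
      case False
      then obtain g where g: "f = m + 1 + g"
        using le_Suc_ex by (metis Suc_eq_plus1 not_less_eq_eq)
      have "e * m \<le> (2 * m - 1) * m"
        using ef(2) by (intro mult_le_mono1) simp
      \<comment> \<open>The slack \<open>d + 2 * g * (m - 1)\<close>, with \<open>d\<close> equal to
        \<open>m - 2\<close>, is positive once \<open>m \<ge> 3\<close>, which excludes equality for
        \<open>f > m\<close>.\<close>
      moreover have "(2 * m - 1) * m + 2 * f + d + 2 * g * (m - 1) = 2 * f * m"
        unfolding g d by (simp add: algebra_simps)
      ultimately show ?thesis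
        using d by linarith
    qed
  qed
  show "real e / real f \<le> 2 - 2 / real (n div 2)"
    using main frac by (simp add: m_def)
  show "f = n div 2 \<and> e + 2 = 2 * f" if "6 \<le> n" "real e / real f = 2 - 2 / real (n div 2)"
  proof -
    have "3 \<le> m"
      using that(1) by (simp add: m_def)
    then show ?thesis
      using main frac(2) that(2) by (simp add: m_def)
  qed
qed

text \<open>It converts a list, indexed from 0, into the vertices \<open>z 1, z 2, ...\<close> of
  the extremal configurations.\<close>

lemma map_nth_upt_1: "map (\<lambda>i. p ! (i - 1)) [1..<Suc (length p)] = p"
  by (rule nth_equalityI) (auto simp del: upt_Suc)

theorem theorem2p6:
  fixes T :: "('a, 'b) pre_digraph" and n :: nat and u w :: 'a
  assumes "undirected_tree T" and "card (verts T) = n" and "n \<ge> 4"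
    and "leaf T u" and "leaf T w"
  shows "ecc T u / ecc T w \<le> 2 - 2 / real (n div 2) \<and>
    (even n \<longrightarrow>
       (even_extremal T n u w \<longrightarrow> ecc T u / ecc T w = 2 - 2 / real (n div 2)) \<and>
       (n \<ge> 6 \<longrightarrow> ecc T u / ecc T w = 2 - 2 / real (n div 2) \<longrightarrow> even_extremal T n u w)) \<and>
    (odd n \<longrightarrow>
       (odd_extremal T n u w \<longrightarrow> ecc T u / ecc T w = 2 - 2 / real (n div 2)) \<and>
       (n \<ge> 6 \<longrightarrow> ecc T u / ecc T w = 2 - 2 / real (n div 2) \<longrightarrow> odd_extremal T n u w))"
proof -
  interpret undirected_tree_graph T
    using assms(1) by (simp add: undirected_tree_iff)
  have uv: "u \<in> verts T" and wv: "w \<in> verts T"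
    using assms by (auto simp: leaf_def)
  \<comment> \<open>For either parity the extremal path is \<open>map z [1..<2 * m]\<close>: it has
    \<open>2 * k + 1\<close> vertices and its centre \<open>z m\<close> stands at list index
    \<open>k\<close>.\<close>
  define m where "m = n div 2"
  define k where "k = m - 1"
  have m: "m = k + 1" "1 \<le> k"
    using assms(3) by (auto simp: m_def k_def)
  have e: "ecc T u = real (gecc u)" "ecc T w = real (gecc w)"
    using ecc_eq_gecc uv wv by auto
  obtain c where c: "w \<rightarrow>\<^bsub>T\<^esub> c" and c_unique: "\<And>d. w \<rightarrow>\<^bsub>T\<^esub> d \<Longrightarrow> d = c"
    using assms(5) leaf_ex1_dominates[OF wv] by blast
  have "c \<noteq> w" "c \<in> verts T"
    using c adj_not_same adj_in_verts by blast+
  then have "0 < gecc w"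
    using gdist_leaf[OF assms(5) c] gdist_le_gecc[of c w] by force
  note bound = ratio_bound[OF assms(3) this gecc_leaf_cases[OF assms(4,5), unfolded assms(2)]]
  have converse: "ecc T u / ecc T w = 2 - 2 / real (n div 2)"
    if z: "z 1 = u" "longest_path T (map z [1..<2 * m])" "w \<rightarrow>\<^bsub>T\<^esub> z m" for z :: "nat \<Rightarrow> 'a"
  proof -
    let ?p = "map z [1..<2 * m]"
    have p: "length ?p = 2 * k + 1" "hd ?p = u" "?p ! k = z m"
      using m z(1) by (auto simp: hd_map simp del: upt_Suc)
    then have "gecc u = 2 * k" "gecc w = k + 1"
      using gecc_extremal[OF z(2), of k w] z(3) by auto
    then show ?thesis
      using m e by (simp add: field_simps flip: m_def)
  qed
  have extremal: "\<exists>p z. longest_path T p \<and> length p = 2 * k + 1 \<and> p = map z [1..<2 * m] \<and>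
      z = (\<lambda>i. p ! (i - 1)) \<and> z 1 = u \<and> w \<rightarrow>\<^bsub>T\<^esub> z m \<and> w \<notin> set p"
    if "6 \<le> n" "ecc T u / ecc T w = 2 - 2 / real (n div 2)"
  proof -
    have "gecc w = m" "gecc u + 2 = 2 * m"
      using bound(2)[OF that(1)] that(2) e by (auto simp: m_def)
    moreover have "2 \<le> k"
      using that(1) by (auto simp: k_def m_def)
    ultimately obtain p where p: "longest_path T p" "length p = 2 * k + 1" "hd p = u"
        "w \<rightarrow>\<^bsub>T\<^esub> p ! k" "w \<notin> set p"
      using extremal_path[OF assms(4,5), of k] m by auto
    have "p \<noteq> []"
      using p(2) by auto
    then show ?thesis
      using p m map_nth_upt_1[of p]
      by (intro exI[of _ p] exI[of _ "\<lambda>i. p ! (i - 1)"]) (simp add: hd_conv_nth)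
  qed
  have even1: "ecc T u / ecc T w = 2 - 2 / real (n div 2)" if "even n" "even_extremal T n u w"
    using that converse by (auto simp: even_extremal_def m_def)
  have even2: "even_extremal T n u w"
    if n: "even n" "6 \<le> n" "ecc T u / ecc T w = 2 - 2 / real (n div 2)"
  proof -
    obtain p and z :: "nat \<Rightarrow> 'a" where "longest_path T p" "p = map z [1..<2 * m]" "z 1 = u" "w \<rightarrow>\<^bsub>T\<^esub> z m"
      using extremal[OF n(2,3)] by metis
    then show ?thesis
      using n(1) by (auto simp: even_extremal_def m_def)
  qed
  have odd1: "ecc T u / ecc T w = 2 - 2 / real (n div 2)" if n: "odd n" "odd_extremal T n u w"
  proof -
    have "n - 1 = 2 * m" "(n - 1) div 2 = m"
      using n(1) by (auto simp: m_def elim: oddE)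
    then show ?thesis
      using n(2) converse by (auto simp: odd_extremal_def)
  qed
  have odd2: "odd_extremal T n u w"
    if n: "odd n" "6 \<le> n" "ecc T u / ecc T w = 2 - 2 / real (n div 2)"
  proof -
    have nm: "n - 1 = 2 * m" "(n - 1) div 2 = m" "n = 2 * k + 3"
      using n(1) m(1) by (auto simp: m_def elim!: oddE)
    obtain p and z :: "nat \<Rightarrow> 'a" where p: "longest_path T p" "length p = 2 * k + 1"
        "p = map z [1..<2 * m]" "z = (\<lambda>i. p ! (i - 1))" "z 1 = u" "w \<rightarrow>\<^bsub>T\<^esub> z m" "w \<notin> set p"
      using extremal[OF n(2,3)] by metis
    have pp: "set p \<subseteq> verts T" "distinct p"
      using p(1) by (auto simp: longest_path_def vpath_iff_successively)
    have "{1..n - 2} = {1..<2 * m}"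
      using nm m by auto
    then have "z ` {1..n - 2} = set (map z [1..<2 * m])"
      by simp
    then have zp: "z ` {1..n - 2} = set p"
      using p(3) by simp
    \<comment> \<open>Of the \<open>2 * k + 3\<close> vertices, \<open>p\<close> takes
      \<open>2 * k + 1\<close> and \<open>w\<close> one more.\<close>
    have "card (verts T - (set p \<union> {w})) = 1"
      using pp p(2,7) wv nm assms(2) by (subst card_Diff_subset) (auto simp: distinct_card)
    then obtain \<omega> where \<omega>: "verts T - (set p \<union> {w}) = {\<omega>}"
      using card_1_singletonE by blast
    then have \<omega>': "\<omega> \<in> verts T" "\<omega> \<notin> set p" "\<omega> \<noteq> w"
      by auto
    have zm: "z m \<in> set p"
      using p(3) m by (auto simp del: upt_Suc)
    have "v \<in> set p" if v: "\<omega> \<rightarrow>\<^bsub>T\<^esub> v" for v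
    proof -
      have "v \<in> verts T" "v \<noteq> \<omega>"
        using v adj_in_verts adj_not_same by blast+
      moreover have "v \<noteq> w"
        using v dominates_sym c_unique p(6) zm \<omega>'(2) by metis
      ultimately show ?thesis
        using \<omega> by blast
    qed
    note off = leaf_off_longest_path[OF p(1) _ \<omega>'(1,2) this]
    have two: "2 \<le> length p"
      using p(2) m(2) by simp
    obtain i where i: "0 < i" "i + 1 < length p" "\<omega> \<rightarrow>\<^bsub>T\<^esub> p ! i"
      using off(2) two by blast
    then have "\<exists>j\<in>{2..n - 3}. \<omega> \<rightarrow>\<^bsub>T\<^esub> z j"
      \<comment> \<open>List index \<open>i\<close> is \<open>z (i + 1)\<close>; as \<open>p\<close>
        has \<open>n - 2\<close> vertices, an interior index gives \<open>j\<close> between 2 and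
        \<open>n - 3\<close>.\<close>
      using p(2,4) nm by (intro bexI[of _ "i + 1"]) auto
    moreover have "longest_path T (map z [1..<n - 1])" "w \<rightarrow>\<^bsub>T\<^esub> z ((n - 1) div 2)"
      using p(1,3,6) unfolding nm(2) by (simp_all only: nm(1))
    moreover have "verts T - (z ` {1..n - 2} \<union> {w}) = {\<omega>}"
      using \<omega> by (simp only: zp)
    ultimately show ?thesis
      unfolding odd_extremal_def using p(5) off(1)[OF two] by blast
  qed
  show ?thesis
    using bound(1) even1 even2 odd1 odd2 e by auto
qed

end
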